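(* Let $n\ge 3$ be an integer and let $$S^3(n)=\{(x,y,z)\in\mathbb{N}^3:\ 0\le x<y<z\le n\}.$$ Then for every integer $l$ with $2\le l\le n-1$, the number of $l$-element subsets of $S^3(n)$ whose points have pairwise distinct $y$-coordinates is strictly greater than the number of $l$-element subsets of $S^3(n)$ whose points have pairwise distinct $x$-coordinates.
   Context: $\mathbb{N}$ denotes the nonnegative integers. *)

theory Defs
  imports Main
begin

definition S3 :: "nat \<Rightarrow> (nat \<times> nat \<times> nat) set" where
  "S3 n = {(x, y, z). 0 \<le> x \<and> x < y \<and> y < z \<and> z \<le> n}"

definition xcoord :: "nat \<times> nat \<times> nat \<Rightarrow> nat" where
  "xcoord = (\<lambda>(x, y, z). x)"

definition ycoord :: "nat \<times> nat \<times> nat \<Rightarrow> nat" where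
  "ycoord = (\<lambda>(x, y, z). y)"

end

theory Submission imports Defs "HOL-Library.FuncSet" begin

text \<open>
  Both counts are elementary symmetric polynomials of degree \<open>l\<close>, evaluated at the fibre sizes of
  the coordinate. These are \<open>a y = y (n - y)\<close> for \<open>ycoord\<close> and the triangular numbers
  \<open>(n - x) (n - x - 1) / 2\<close> for \<open>xcoord\<close>. Both families have \<open>n - 1\<close> members and the same sum,
  the size of \<open>S3 n\<close>. Sorting both increasingly pairs them up as families \<open>a\<close> and \<open>b\<close> over
  \<open>{1..n-1}\<close> for which a threshold \<open>c\<close> satisfies \<open>b i \<le> a i \<le> c\<close> or \<open>c \<le> a i \<le> b i\<close>
  for every \<open>i\<close>. So \<open>b\<close> can be changed into \<open>a\<close> by moving single units from members above \<open>c\<close> to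
  members below \<open>c\<close>, and each such move strictly increases the symmetric polynomial.
\<close>

section \<open>Elementary symmetric polynomials and unit transfers\<close>

definition elem_sym :: "('a \<Rightarrow> nat) \<Rightarrow> 'a set \<Rightarrow> nat \<Rightarrow> nat" where
  "elem_sym w I l = (\<Sum>A | A \<subseteq> I \<and> card A = l. \<Prod>i\<in>A. w i)"

lemma elem_sym_cong:
  assumes "\<And>i. i \<in> I \<Longrightarrow> v i = w i"
  shows "elem_sym v I l = elem_sym w I l"
  unfolding elem_sym_def
proof (rule sum.cong[OF refl])
  fix A assume "A \<in> {A. A \<subseteq> I \<and> card A = l}"
  then show "prod v A = prod w A"
    using assms by (intro prod.cong) auto
qed

lemma elem_sym_insert:
  assumes "finite I" "i \<notin> I"
  shows "elem_sym w (insert i I) (Suc l) = elem_sym w I (Suc l) + w i * elem_sym w I l"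
proof -
  let ?P = "\<lambda>I l. {A. A \<subseteq> I \<and> card A = l}"
  have fin: "finite A" if "A \<subseteq> I" for A
    using that assms(1) by (rule finite_subset)
  have split: "?P (insert i I) (Suc l) = ?P I (Suc l) \<union> insert i ` ?P I l"
  proof (intro set_eqI iffI)
    fix A assume A: "A \<in> ?P (insert i I) (Suc l)"
    show "A \<in> ?P I (Suc l) \<union> insert i ` ?P I l"
    proof (cases "i \<in> A")
      case True
      with A have "A = insert i (A - {i})" "A - {i} \<in> ?P I l"
        by auto
      then show ?thesis by blast
    qed (use A in auto)
  next
    fix A assume "A \<in> ?P I (Suc l) \<union> insert i ` ?P I l"
    then show "A \<in> ?P (insert i I) (Suc l)"
      using assms(2) fin by (auto simp: card_insert_if)
  qed
  have inj: "inj_on (insert i) (?P I l)"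
    using assms(2) by (auto simp: inj_on_def dest: insert_ident[THEN iffD1, rotated 2])
  have "elem_sym w (insert i I) (Suc l)
      = (\<Sum>A\<in>?P I (Suc l). prod w A) + (\<Sum>A\<in>insert i ` ?P I l. prod w A)"
    unfolding elem_sym_def split
    by (rule sum.union_disjoint) (use assms in auto)
  also have "(\<Sum>A\<in>insert i ` ?P I l. prod w A) = (\<Sum>A\<in>?P I l. prod w (insert i A))"
    by (simp add: sum.reindex[OF inj])
  also have "\<dots> = (\<Sum>A\<in>?P I l. w i * prod w A)"
    by (rule sum.cong[OF refl], subst prod.insert) (use assms(2) fin in auto)
  finally show ?thesis
    by (simp add: elem_sym_def sum_distrib_left)
qed

lemma elem_sym_pos:
  assumes "finite I" "\<And>i. i \<in> I \<Longrightarrow> w i > 0" "l \<le> card I"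
  shows "elem_sym w I l > 0"
proof -
  obtain A where A: "A \<subseteq> I" "card A = l"
    using obtain_subset_with_card_n[OF assms(3)] by blast
  have "prod w A > 0"
    using A assms(2) by (intro prod_pos) auto
  moreover have "finite {A. A \<subseteq> I \<and> card A = l}"
    using assms(1) by simp
  ultimately show ?thesis
    unfolding elem_sym_def using A by (intro sum_pos2[of _ A]) auto
qed

text \<open>Splitting off \<open>i\<close> and \<open>j\<close> leaves an expression depending on
  \<open>w i\<close> and \<open>w j\<close> only through their sum and product. The move keeps the
  sum and raises the product, whose coefficient, of degree \<open>l - 2\<close>, is
  positive.\<close>

lemma elem_sym_transfer:
  assumes fin: "finite I" and ij: "i \<in> I" "j \<in> I" "i \<noteq> j"
    and pos: "\<And>k. k \<in> I \<Longrightarrow> w k > 0"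
    and l: "2 \<le> l" "l \<le> card I"
    and less: "w i + 2 \<le> w j"
  shows "elem_sym w I l < elem_sym (w(i := w i + 1, j := w j - 1)) I l"
proof -
  define J where "J = I - {i, j}"
  define v where "v = w(i := w i + 1, j := w j - 1)"
  have I: "I = insert i (insert j J)" and notin: "i \<notin> insert j J" "j \<notin> J" and finJ: "finite J"
    using ij fin by (auto simp: J_def)
  have cardJ: "card I = card J + 2"
    using notin finJ by (simp add: I)
  obtain m where m: "l = Suc (Suc m)"
    using l(1) by (metis add_2_eq_Suc le_Suc_ex)
  have expand: "elem_sym u I l = elem_sym u J l + (u i + u j) * elem_sym u J (Suc m)
      + u i * u j * elem_sym u J m" for u
    unfolding I m using notin finJ by (simp add: elem_sym_insert algebra_simps)
  have vJ: "elem_sym v J k = elem_sym w J k" for k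
    by (rule elem_sym_cong) (auto simp: v_def J_def)
  \<comment> \<open>The product grows by exactly \<open>d + 1\<close>.\<close>
  obtain d where d: "w j = w i + 2 + d"
    using less le_Suc_ex by blast
  have "v i + v j = w i + w j" "w i * w j < v i * v j"
    using ij(3) d by (auto simp: v_def algebra_simps)
  moreover have "elem_sym w J m > 0"
    by (rule elem_sym_pos) (use finJ pos l cardJ m in \<open>auto simp: J_def\<close>)
  ultimately show ?thesis
    unfolding v_def[symmetric] expand vJ by simp
qed

text \<open>Induction on the total excess of \<open>b\<close> over \<open>a\<close>: equal sums
  force both a deficient index \<open>i\<close> and a surplus index \<open>j\<close>, and a unit
  moved from \<open>j\<close> to \<open>i\<close> preserves all hypotheses except possibly
  \<open>neq\<close>.\<close>

lemma elem_sym_less: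
  fixes a b :: "'a \<Rightarrow> nat"
  assumes fin: "finite I"
    and l: "2 \<le> l" "l \<le> card I"
    and cross: "\<And>i. i \<in> I \<Longrightarrow> b i \<le> a i \<and> a i \<le> c \<or> c \<le> a i \<and> a i \<le> b i"
    and pos: "\<And>i. i \<in> I \<Longrightarrow> 0 < b i"
    and sums: "sum a I = sum b I"
    and neq: "\<exists>i\<in>I. a i \<noteq> b i"
  shows "elem_sym b I l < elem_sym a I l"
  using cross pos sums neq
proof (induction "\<Sum>i\<in>I. b i - a i" arbitrary: b rule: less_induct)
  case less
  note cross = less.prems(1) and pos = less.prems(2) and sums = less.prems(3)
  have "\<exists>i\<in>I. b i < a i"
  proof (rule ccontr)
    assume "\<not> ?thesis"
    then have "\<And>i. i \<in> I \<Longrightarrow> a i \<le> b i" by (simp add: not_less)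
    with less.prems(4) fin have "sum a I < sum b I"
      by (intro sum_strict_mono_ex1) (auto, metis le_neq_implies_less)
    with sums show False by simp
  qed
  then obtain i where i: "i \<in> I" "b i < a i" by blast
  have "\<exists>j\<in>I. a j < b j"
  proof (rule ccontr)
    assume "\<not> ?thesis"
    then have "\<And>i. i \<in> I \<Longrightarrow> b i \<le> a i" by (simp add: not_less)
    with less.prems(4) fin have "sum b I < sum a I"
      by (intro sum_strict_mono_ex1) (auto, metis le_neq_implies_less)
    with sums show False by simp
  qed
  then obtain j where j: "j \<in> I" "a j < b j" by blast
  have ij: "i \<noteq> j" using i j by auto
  define b' where "b' = b(i := b i + 1, j := b j - 1)"
  \<comment> \<open>The threshold separates the two:
    \<open>b i < a i \<le> c \<le> a j < b j\<close>.\<close>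
  have gap: "b i + 2 \<le> b j"
    using cross[OF i(1)] cross[OF j(1)] i j by linarith
  have step: "elem_sym b I l < elem_sym b' I l"
    unfolding b'_def using fin i(1) j(1) ij pos l gap by (rule elem_sym_transfer)
  show ?case
  proof (cases "\<exists>k\<in>I. a k \<noteq> b' k")
    case False
    then have "elem_sym b' I l = elem_sym a I l"
      by (intro elem_sym_cong) auto
    with step show ?thesis by simp
  next
    case True
    have "(\<Sum>k\<in>I. b' k - a k) < (\<Sum>k\<in>I. b k - a k)"
    proof (rule sum_strict_mono_ex1[OF fin])
      \<comment> \<open>Truncated subtraction keeps the term at \<open>i\<close> zero, since
        \<open>b i + 1 \<le> a i\<close>.\<close>
      show "\<forall>k\<in>I. b' k - a k \<le> b k - a k"
        using i by (auto simp: b'_def)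
      show "\<exists>k\<in>I. b' k - a k < b k - a k"
        using j by (intro bexI[of _ j]) (auto simp: b'_def)
    qed
    moreover have "b' k \<le> a k \<and> a k \<le> c \<or> c \<le> a k \<and> a k \<le> b' k" if "k \<in> I" for k
      using cross[OF that] i j by (auto simp: b'_def)
    moreover have "0 < b' k" if "k \<in> I" for k
      using pos[OF that] j gap by (auto simp: b'_def)
    moreover have "sum a I = sum b' I"
    proof -
      have split: "sum u I = u i + (u j + sum u (I - {i} - {j}))" for u :: "'a \<Rightarrow> nat"
        using fin i(1) j(1) ij by (simp add: sum.remove[of I i] sum.remove[of "I - {i}" j])
      have "sum b' (I - {i} - {j}) = sum b (I - {i} - {j})"
        by (rule sum.cong) (auto simp: b'_def)
      moreover have "b' i + b' j = b i + b j"
        using ij gap by (simp add: b'_def)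
      ultimately show ?thesis
        using sums split[of b] split[of b'] by simp
    qed
    ultimately have "elem_sym b' I l < elem_sym a I l"
      using True by (intro less.hyps)
    with step show ?thesis by simp
  qed
qed

section \<open>Counting subsets on which a map is injective\<close>

text \<open>Such a set picks one point from each fibre over \<open>B\<close>, so it is the image of
  exactly one choice function in \<open>PiE\<close>.\<close>

lemma card_sections:
  assumes "finite B"
  shows "card {A. A \<subseteq> S \<and> inj_on f A \<and> f ` A = B} = (\<Prod>b\<in>B. card {s \<in> S. f s = b})"
proof -
  let ?F = "PiE B (\<lambda>b. {s \<in> S. f s = b})"
  have sec: "f (\<phi> b) = b" "\<phi> b \<in> S" if "\<phi> \<in> ?F" "b \<in> B" for \<phi> b
    using PiE_mem[OF that] by auto
  have "bij_betw (\<lambda>\<phi>. \<phi> ` B) ?F {A. A \<subseteq> S \<and> inj_on f A \<and> f ` A = B}"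
  proof (rule bij_betw_imageI)
    show "inj_on (\<lambda>\<phi>. \<phi> ` B) ?F"
    proof (rule inj_onI)
      fix \<phi> \<psi> assume *: "\<phi> \<in> ?F" "\<psi> \<in> ?F" "\<phi> ` B = \<psi> ` B"
      show "\<phi> = \<psi>"
      proof (rule PiE_ext[OF *(1,2)])
        fix b assume b: "b \<in> B"
        with *(3) obtain b' where "b' \<in> B" "\<phi> b = \<psi> b'" by blast
        then show "\<phi> b = \<psi> b"
          using b sec(1)[OF *(1)] sec(1)[OF *(2)] by metis
      qed
    qed
    show "(\<lambda>\<phi>. \<phi> ` B) ` ?F = {A. A \<subseteq> S \<and> inj_on f A \<and> f ` A = B}"
    proof (intro set_eqI iffI)
      fix A assume "A \<in> (\<lambda>\<phi>. \<phi> ` B) ` ?F"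
      then obtain \<phi> where \<phi>: "\<phi> \<in> ?F" "A = \<phi> ` B" by blast
      have "f ` A = B" "inj_on f A" "A \<subseteq> S"
        using sec[OF \<phi>(1)] by (auto simp: \<phi>(2) image_image inj_on_def)
      then show "A \<in> {A. A \<subseteq> S \<and> inj_on f A \<and> f ` A = B}" by simp
    next
      fix A assume "A \<in> {A. A \<subseteq> S \<and> inj_on f A \<and> f ` A = B}"
      then have A: "A \<subseteq> S" "inj_on f A" "f ` A = B" by auto
      let ?\<phi> = "restrict (inv_into A f) B"
      have "?\<phi> ` B = A"
        using A(2,3) by (auto simp: image_image)
      moreover have "?\<phi> \<in> ?F"
        using A inv_into_into[of _ f A] f_inv_into_f[of _ f A] by auto
      ultimately show "A \<in> (\<lambda>\<phi>. \<phi> ` B) ` ?F" by (intro image_eqI[of _ _ ?\<phi>]) simp_all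
    qed
  qed
  then show ?thesis
    using assms by (simp add: card_PiE flip: bij_betw_same_card)
qed

text \<open>Group the sets by their image under \<open>f\<close>, which has \<open>l\<close>
  elements by injectivity.\<close>

lemma card_inj_on_subsets:
  assumes "finite S" "finite I" "f ` S \<subseteq> I"
  shows "card {A. A \<subseteq> S \<and> card A = l \<and> inj_on f A} = elem_sym (\<lambda>i. card {s \<in> S. f s = i}) I l"
proof -
  let ?C = "\<lambda>B. {A. A \<subseteq> S \<and> inj_on f A \<and> f ` A = B}"
  have "{A. A \<subseteq> S \<and> card A = l \<and> inj_on f A} = (\<Union>B\<in>{B. B \<subseteq> I \<and> card B = l}. ?C B)"
    using assms(3) by (force simp: card_image)
  also have "card \<dots> = (\<Sum>B | B \<subseteq> I \<and> card B = l. card (?C B))"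
    by (rule card_UN_disjoint) (use assms in auto)
  also have "\<dots> = elem_sym (\<lambda>i. card {s \<in> S. f s = i}) I l"
    unfolding elem_sym_def
    by (rule sum.cong[OF refl], rule card_sections) (use assms(2) finite_subset in auto)
  finally show ?thesis .
qed

lemma sum_card_fibres:
  assumes "finite S" "finite I" "f ` S \<subseteq> I"
  shows "(\<Sum>i\<in>I. card {s \<in> S. f s = i}) = card S"
proof -
  have "S = (\<Union>i\<in>I. {s \<in> S. f s = i})"
    using assms(3) by auto
  also have "card \<dots> = (\<Sum>i\<in>I. card {s \<in> S. f s = i})"
    by (rule card_UN_disjoint) (use assms in auto)
  finally show ?thesis by simp
qed

section \<open>Fibre sizes of the two coordinates\<close>

lemma finite_S3: "finite (S3 n)"
  by (rule finite_subset[of _ "{..n} \<times> {..n} \<times> {..n}"]) (auto simp: S3_def)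

lemma card_ycoord_fibre: "card {s \<in> S3 n. ycoord s = y} = y * (n - y)"
proof -
  have "{s \<in> S3 n. ycoord s = y} = (\<lambda>(x, z). (x, y, z)) ` ({..<y} \<times> {y<..n})"
    by (auto simp: S3_def ycoord_def)
  also have "card \<dots> = card ({..<y} \<times> {y<..n})"
    by (rule card_image) (auto simp: inj_on_def)
  finally show ?thesis by simp
qed

text \<open>Raising \<open>m\<close> by one adds the \<open>m\<close> pairs with
  \<open>z = x + Suc m\<close>. The factor 2 avoids division.\<close>

lemma card_increasing_pairs: "2 * card {(y, z). x < y \<and> y < z \<and> z \<le> x + m} = m * (m - 1)"
proof (induction m)
  case 0
  have "{(y, z). x < y \<and> y < z \<and> z \<le> x + 0} = {}" by auto
  then show ?case by (simp only: card.empty)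
next
  case (Suc m)
  let ?P = "\<lambda>m. {(y, z). x < y \<and> y < z \<and> z \<le> x + m}"
  have "?P (Suc m) = ?P m \<union> {x<..x + m} \<times> {x + Suc m}"
    by auto
  also have "card \<dots> = card (?P m) + card ({x<..x + m} \<times> {x + Suc m})"
    by (rule card_Un_disjoint)
      (auto intro: finite_subset[of _ "{..x + m} \<times> {..x + m}"])
  finally show ?case
    using Suc by (cases m) (auto simp: algebra_simps)
qed

lemma card_xcoord_fibre:
  "2 * card {s \<in> S3 n. xcoord s = x} = (n - x) * (n - x - 1)"
proof (cases "x \<le> n")
  case True
  have "{s \<in> S3 n. xcoord s = x} = Pair x ` {(y, z). x < y \<and> y < z \<and> z \<le> x + (n - x)}"
    using True by (auto simp: S3_def xcoord_def)
  then have "card {s \<in> S3 n. xcoord s = x} = card {(y, z). x < y \<and> y < z \<and> z \<le> x + (n - x)}"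
    by (simp only: card_image inj_on_def prod.inject simp_thms ball_triv)
  then show ?thesis
    by (simp only: card_increasing_pairs)
next
  case False
  then have "{s \<in> S3 n. xcoord s = x} = {}"
    by (auto simp: S3_def xcoord_def)
  then show ?thesis using False by (simp only: card.empty)
qed

text \<open>
  Relabels the \<open>x\<close>-values so that the fibre over \<open>y\<close> has the same rank by size as the \<open>ycoord\<close>
  fibre over \<open>y\<close>; the sizes \<open>y (n - y)\<close> increase in the order \<open>1, n - 1, 2, n - 2, \<dots>\<close> of \<open>y\<close>.
\<close>
definition match :: "nat \<Rightarrow> nat \<Rightarrow> nat" where
  "match n x = (if even (n + x) then (n - x) div 2 else (n + x + 1) div 2)"

text \<open>The explicit inverse of \<open>match n\<close>: even \<open>n - x\<close> corresponds to
  \<open>n - x = 2 * y\<close> in the lower half, odd \<open>n - x\<close> to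
  \<open>n - x = 2 * (n - y) + 1\<close> in the upper half.\<close>

lemma match_eq_iff:
  assumes "x + 2 \<le> n" "y \<in> {1..n - 1}"
  shows "match n x = y \<longleftrightarrow> x = (if 2 * y \<le> n then n - 2 * y else 2 * y - n - 1)"
  using assms unfolding match_def by (auto; presburger)

lemma match_in_range:
  assumes "x + 2 \<le> n"
  shows "match n x \<in> {1..n - 1}"
  using assms unfolding match_def by (auto; presburger)

lemma card_match_fibre:
  assumes "y \<in> {1..n - 1}"
  shows "card {s \<in> S3 n. match n (xcoord s) = y}
    = (if 2 * y \<le> n then y * (2 * y - 1) else (n - y) * (2 * (n - y) + 1))"
proof -
  let ?x = "if 2 * y \<le> n then n - 2 * y else 2 * y - n - 1"
  have "{s \<in> S3 n. match n (xcoord s) = y} = {s \<in> S3 n. xcoord s = ?x}"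
  proof (intro Collect_cong conj_cong refl)
    fix s assume "s \<in> S3 n"
    then have "xcoord s + 2 \<le> n" by (auto simp: S3_def xcoord_def)
    then show "match n (xcoord s) = y \<longleftrightarrow> xcoord s = ?x"
      using assms by (rule match_eq_iff)
  qed
  then have *: "2 * card {s \<in> S3 n. match n (xcoord s) = y} = (n - ?x) * (n - ?x - 1)"
    by (simp only: card_xcoord_fibre)
  show ?thesis
  proof (cases "2 * y \<le> n")
    case True
    then have "n - ?x = 2 * y" by simp
    with * True show ?thesis by simp
  next
    case False
    then have "n - ?x = 2 * (n - y) + 1" using assms by auto
    then have "2 * card {s \<in> S3 n. match n (xcoord s) = y} = 2 * ((n - y) * (2 * (n - y) + 1))"
      unfolding * by simp
    with False show ?thesis by simp
  qed
qed

section \<open>Threshold comparison of matched fibres\<close>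

text \<open>The difference of the two sides is \<open>(j - i) * (n - i - j)\<close>.\<close>

lemma mult_diff_mono:
  fixes i j n :: nat
  assumes "i \<le> j" "i + j \<le> n"
  shows "i * (n - i) \<le> j * (n - j)"
proof -
  obtain d e where "j = i + d" "n = i + j + e"
    using assms le_Suc_ex by metis
  then show ?thesis by (simp add: algebra_simps)
qed

text \<open>Cancelling the common factor, \<open>b \<le> a\<close> means
  \<open>3 * y \<le> n + 1\<close> in the lower half and \<open>3 * j + 1 \<le> n\<close> with
  \<open>j = n - y\<close> in the upper half. Both changes of sign occur around \<open>J\<close>, so
  one threshold serves both halves.\<close>

lemma fibres_cross:
  fixes n y :: nat
  assumes "n \<ge> 3" and y: "y \<in> {1..n - 1}"
  defines "a \<equiv> y * (n - y)"
    and "b \<equiv> if 2 * y \<le> n then y * (2 * y - 1) else (n - y) * (2 * (n - y) + 1)"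
    and "J \<equiv> (n + 1) div 3"
  shows "b \<le> a \<and> a \<le> J * (n - J) \<or> J * (n - J) \<le> a \<and> a \<le> b"
proof (cases "2 * y \<le> n")
  case True
  then have b: "b = y * (2 * y - 1)" by (simp add: b_def)
  show ?thesis
  proof (cases "y \<le> J")
    case True
    have "a \<le> J * (n - J)"
      unfolding a_def using True assms(1) by (intro mult_diff_mono) (auto simp: J_def)
    moreover have "b \<le> a"
      unfolding a_def b using True by (intro mult_left_mono) (auto simp: J_def)
    ultimately show ?thesis by simp
  next
    case False
    have "J * (n - J) \<le> a"
      unfolding a_def using False \<open>2 * y \<le> n\<close> by (intro mult_diff_mono) auto
    moreover have "a \<le> b"
      unfolding a_def b using False by (intro mult_left_mono) (auto simp: J_def)
    ultimately show ?thesis by simp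
  qed
next
  case False
  define j where "j = n - y"
  have b: "b = j * (2 * j + 1)" and a: "a = j * (n - j)" and j: "2 * j \<le> n"
    using False y by (auto simp: b_def a_def j_def)
  show ?thesis
  proof (cases "3 * j + 1 \<le> n")
    case True
    have "a \<le> J * (n - J)"
      unfolding a using True assms(1) by (intro mult_diff_mono) (auto simp: J_def)
    moreover have "b \<le> a"
      unfolding a b using True by (intro mult_left_mono) auto
    ultimately show ?thesis by simp
  next
    case False
    then have "J \<le> j" by (auto simp: J_def)
    then have "J * (n - J) \<le> a"
      unfolding a using j by (intro mult_diff_mono) auto
    moreover have "a \<le> b"
      unfolding a b using False by (intro mult_left_mono) auto
    ultimately show ?thesis by simp
  qed
qed

theorem theorem1:
  fixes n l :: nat
  assumes "n \<ge> 3" and "2 \<le> l" and "l \<le> n - 1"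
  shows "card {A. A \<subseteq> S3 n \<and> card A = l \<and> inj_on ycoord A}
       > card {A. A \<subseteq> S3 n \<and> card A = l \<and> inj_on xcoord A}"
proof -
  let ?I = "{1..n - 1}"
  let ?h = "\<lambda>s. match n (xcoord s)"
  let ?a = "\<lambda>y. card {s \<in> S3 n. ycoord s = y}"
  let ?b = "\<lambda>y. card {s \<in> S3 n. ?h s = y}"
  have x_bound: "xcoord s + 2 \<le> n" if "s \<in> S3 n" for s
    using that by (auto simp: S3_def xcoord_def)
  have y_img: "ycoord ` S3 n \<subseteq> ?I"
    by (auto simp: S3_def ycoord_def)
  have h_img: "?h ` S3 n \<subseteq> ?I"
    using match_in_range[OF x_bound] by blast
  \<comment> \<open>Relabelling by \<open>match n\<close> is injective on the occurring x-values, so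
    it does not change which sets are counted.\<close>
  have h_inj: "xcoord s = xcoord t" if "s \<in> S3 n" "t \<in> S3 n" "?h s = ?h t" for s t
    using that match_eq_iff[OF x_bound match_in_range[OF x_bound]] by metis
  have "inj_on xcoord A \<longleftrightarrow> inj_on ?h A" if "A \<subseteq> S3 n" for A
    using that h_inj unfolding inj_on_def by (metis subsetD)
  then have "card {A. A \<subseteq> S3 n \<and> card A = l \<and> inj_on xcoord A}
      = card {A. A \<subseteq> S3 n \<and> card A = l \<and> inj_on ?h A}"
    by (metis (no_types, lifting))
  also have "\<dots> = elem_sym ?b ?I l"
    by (rule card_inj_on_subsets) (use finite_S3 h_img in auto)
  also have "\<dots> < elem_sym ?a ?I l"
  proof (rule elem_sym_less)
    show "?b y \<le> ?a y \<and> ?a y \<le> (n + 1) div 3 * (n - (n + 1) div 3)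
        \<or> (n + 1) div 3 * (n - (n + 1) div 3) \<le> ?a y \<and> ?a y \<le> ?b y" if "y \<in> ?I" for y
      unfolding card_match_fibre[OF that] card_ycoord_fibre
      using fibres_cross[OF assms(1) that] .
    show "0 < ?b y" if "y \<in> ?I" for y
      unfolding card_match_fibre[OF that] using that by auto
    show "sum ?a ?I = sum ?b ?I"
      using sum_card_fibres[OF finite_S3 _ y_img] sum_card_fibres[OF finite_S3 _ h_img] by simp
    \<comment> \<open>At \<open>y = 1\<close> the sizes are \<open>n - 1\<close> and
      \<open>1\<close>, which differ because \<open>n \<ge> 3\<close>.\<close>
    have "1 \<in> ?I" using assms(1) by simp
    moreover from this have "?a 1 \<noteq> ?b 1"
      unfolding card_match_fibre[OF \<open>1 \<in> ?I\<close>] card_ycoord_fibre using assms(1) by simp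
    ultimately show "\<exists>y\<in>?I. ?a y \<noteq> ?b y" by blast
  qed (use assms in simp_all)
  also have "\<dots> = card {A. A \<subseteq> S3 n \<and> card A = l \<and> inj_on ycoord A}"
    by (rule card_inj_on_subsets[symmetric]) (use finite_S3 y_img in auto)
  finally show ?thesis .
qed

end
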